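(* Let $Q$ be a real-valued function on the unit circle $\mathbf{T}$. If there exists a constant $\rho>-\frac12$ such that $t\mapsto Q\bigl(e^{\sqrt{-1}t}\bigr)-\frac{\rho}{2}t^2$ is convex on $\mathbf{R}$, then $$W_{|\cdot|}(\mu,\mu_Q)\le W(\mu,\mu_Q)\le\sqrt{\frac{2}{1+2\rho}\,\widetilde{\Sigma}_Q(\mu)}$$ for every Borel probability measure $\mu\in\mathcal{M}(\mathbf{T})$.
   Context: $\mathcal{M}(\mathbf{T})$ is the set of Borel probability measures on the unit circle $\mathbf{T}$. Wasserstein distances: for a metric $d$ on $\mathbf{T}$ the associated (quadratic) Wasserstein distance between $\mu,\nu\in\mathcal{M}(\mathbf{T})$ is $$\inf_{\pi\in\Pi(\mu,\nu)}\sqrt{\iint_{\mathbf{T}\times\mathbf{T}}\tfrac12 d(\zeta,\eta)^2\,d\pi(\zeta,\eta)},$$ where $\Pi(\mu,\nu)$ is the set of probability measures on $\mathbf{T}\times\mathbf{T}$ with marginals $\mu,\nu$. $W_{|\cdot|}(\mu,\nu)$ denotes this for $d(\zeta,\eta)=|\zeta-\eta|$, and $W(\mu,\nu)$ denotes it for the geodesic (angular) distance $d$ on $\mathbf{T}$. Free entropy: $\Sigma(\mu):=\iint_{\mathbf{T}^2}\log|\zeta-\eta|\,d\mu(\zeta)\,d\mu(\eta)\in[-\infty,\infty)$. For a real-valued continuous $Q$ on $\mathbf{T}$ (continuity is automatic under the convexity hypothesis of the claim), the functional $-\Sigma(\mu)+\int_{\mathbf{T}}Q\,d\mu$ on $\mathcal{M}(\mathbf{T})$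 has a unique minimizer $\mu_Q$ with finite value; set $B(Q):=\Sigma(\mu_Q)-\int_{\mathbf{T}}Q\,d\mu_Q$. The relative free entropy is $$\widetilde{\Sigma}_Q(\mu):=-\Sigma(\mu)+\int_{\mathbf{T}}Q(\zeta)\,d\mu(\zeta)+B(Q).$$ *)

theory Defs
  imports "HOL-Probability.Probability"
begin

abbreviation circle :: "complex set" where
  "circle \<equiv> sphere 0 1"

definition circle_measures :: "complex measure set" where
  "circle_measures =
     {\<mu>. prob_space \<mu> \<and> sets \<mu> = sets (restrict_space borel circle)}"

definition angular_dist :: "complex \<Rightarrow> complex \<Rightarrow> real" where
  "angular_dist \<zeta> \<eta> = \<bar>Arg (\<zeta> / \<eta>)\<bar>"

(* The product of the Borel sigma-algebras is the Borel sigma-algebra of the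
   product, the circle being second countable. *)
definition couplings :: "complex measure \<Rightarrow> complex measure \<Rightarrow> (complex \<times> complex) measure set" where
  "couplings \<mu> \<nu> =
     {\<pi>. prob_space \<pi> \<and>
          sets \<pi> = sets (restrict_space borel circle \<Otimes>\<^sub>M restrict_space borel circle) \<and>
          distr \<pi> (restrict_space borel circle) fst = \<mu> \<and>
          distr \<pi> (restrict_space borel circle) snd = \<nu>}"

(* Real-valued, and to be used for distances that are bounded and measurable on
   the circle, as dist and angular_dist are: then every integral below exists,
   and the infimum is over a nonempty set (it contains the product measure) of
   nonnegative reals. *)
definition wasserstein ::
    "(complex \<Rightarrow> complex \<Rightarrow> real) \<Rightarrow> complex measure \<Rightarrow> complex measure \<Rightarrow> real" where
  "wasserstein d \<mu> \<nu> =
     (INF \<pi>\<in>couplings \<mu> \<nu>. sqrt (\<integral>p. 1/2 * (d (fst p) (snd p))\<^sup>2 \<partial>\<pi>))"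

(* Integral of an extended-real function as the difference of the integrals of
   its positive and negative parts; e2ennreal maps negative numbers to 0.
   Meaningful as soon as one of the two parts has a finite integral. *)
definition ereal_integral :: "'a measure \<Rightarrow> ('a \<Rightarrow> ereal) \<Rightarrow> ereal" where
  "ereal_integral M f =
     enn2ereal (\<integral>\<^sup>+x. e2ennreal (f x) \<partial>M) - enn2ereal (\<integral>\<^sup>+x. e2ennreal (- f x) \<partial>M)"

(* The library has ln 0 = 0, so the value on the diagonal is set explicitly. *)
definition log_dist :: "complex \<Rightarrow> complex \<Rightarrow> ereal" where
  "log_dist \<zeta> \<eta> = (if \<zeta> = \<eta> then - \<infinity> else ereal (ln (cmod (\<zeta> - \<eta>))))"

definition free_entropy :: "complex measure \<Rightarrow> ereal" where
  "free_entropy \<mu> = ereal_integral (\<mu> \<Otimes>\<^sub>M \<mu>) (\<lambda>p. log_dist (fst p) (snd p))"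

(* A potential on the circle is given by a function on the complex plane, of
   which only the values on the circle are used. *)
definition weighted_energy :: "(complex \<Rightarrow> real) \<Rightarrow> complex measure \<Rightarrow> ereal" where
  "weighted_energy Q \<mu> = - free_entropy \<mu> + ereal (\<integral>\<zeta>. Q \<zeta> \<partial>\<mu>)"

(* For Q continuous on the circle there is exactly one minimizer, hence no choice
   is involved. *)
definition equilibrium_measure :: "(complex \<Rightarrow> real) \<Rightarrow> complex measure" where
  "equilibrium_measure Q = arg_min_on (weighted_energy Q) circle_measures"

definition B_const :: "(complex \<Rightarrow> real) \<Rightarrow> ereal" where
  "B_const Q = free_entropy (equilibrium_measure Q) - ereal (\<integral>\<zeta>. Q \<zeta> \<partial>equilibrium_measure Q)"

definition relative_free_entropy :: "(complex \<Rightarrow> real) \<Rightarrow> complex measure \<Rightarrow> ereal" where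
  "relative_free_entropy Q \<mu> = - free_entropy \<mu> + ereal (\<integral>\<zeta>. Q \<zeta> \<partial>\<mu>) + B_const Q"

(* On negative arguments this follows the odd extension of the library's sqrt. *)
definition ereal_sqrt :: "ereal \<Rightarrow> ereal" where
  "ereal_sqrt x = (if \<bar>x\<bar> = \<infinity> then x else ereal (sqrt (real_of_ereal x)))"

end

theory Submission
  imports Defs
begin

text \<open>
  The proof is a displacement-convexity argument, carried out in coordinates in which displacement
  interpolation is plain convex combination. Put Lebesgue measure on the open unit interval. Every
  Borel probability measure on the circle is the law of \<open>cis (X u)\<close> for some nondecreasing
  \<open>X\<close> with \<open>X (u + 1) = X u + 2 * pi\<close> (\<open>degree_one_lift\<close>): extend the quantile function of the
  argument quasi-periodically. Rotating the parameter \<open>u\<close> keeps the law and changes the mean of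
  \<open>X\<close> by any prescribed amount, so the mean may be taken to be zero
  (\<open>circle_measure_centred_lift\<close>). Lifts with mean zero form a convex set.

  Up to the additive constant \<open>- ln 2\<close>, the negative free entropy of the law is the double integral of
  \<open>- ln \<bar>sin ((X u - X v) / 2)\<bar>\<close>. For \<open>v \<le> u \<le> v + 1\<close> the difference \<open>X u - X v\<close> lies in
  \<open>[0, 2 * pi]\<close>, and there \<open>- ln (sin (x / 2))\<close> has second derivative
  \<open>1 / (4 * (sin (x / 2))\<^sup>2) \<ge> 1 / 4\<close>. With \<open>D = Y - X\<close> the convexity defect along the segment from
  \<open>X\<close> to \<open>Y\<close> is therefore controlled by the double integral of \<open>(D u - D v)\<^sup>2\<close>, which is twice the
  integral of \<open>D\<^sup>2\<close> because \<open>D\<close> has mean zero (\<open>log_energy_strongly_convex\<close>). The potential adds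
  the modulus \<open>\<rho>\<close>, so the weighted energy is \<open>(1/2 + \<rho>)\<close>-strongly convex in the squared norm of
  \<open>L\<^sup>2\<close>.

  A strongly convex function exceeds its minimum by at least half the modulus times the squared
  distance to the minimizer (\<open>displacement_energy_gap\<close>). If \<open>X\<close> lifts the equilibrium measure and
  \<open>Y\<close> lifts \<open>\<mu>\<close>, the excess is the relative free entropy, and the joint law of \<open>cis (Y u)\<close> and
  \<open>cis (X u)\<close> is a coupling whose cost is at most half the integral of \<open>(Y - X)\<^sup>2\<close>, since the angular
  distance never exceeds the difference of lifts. These two facts give the transportation inequality,
  for which only an upper bound on the infimum over couplings is required. The two Wasserstein
  distances compare because a chord is no longer than its arc.

  That the equilibrium measure is a minimizer at all is shown by compactness: the arguments of
  a minimizing sequence have a weakly convergent subsequence, which Skorohod's theorem realizes as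
  a pointwise convergent sequence of angles, and Fatou's lemma makes the energy lower
  semicontinuous along it (\<open>weighted_energy_minimizer_exists\<close>).
\<close>

section \<open>Angles and distances on the circle\<close>

text \<open>
  The argument is continuous off the closed negative real axis and constant on that axis apart from
  the origin.
\<close>

lemma borel_measurable_Arg [measurable]: "Arg \<in> borel_measurable borel"
proof -
  define g where "g = (\<lambda>z. if z \<in> - \<real>\<^sub>\<le>\<^sub>0 then Arg z else pi)"
  have "g \<in> borel_measurable borel"
    unfolding g_def
    by (intro borel_measurable_continuous_on_if continuous_at_imp_continuous_on ballI
          continuous_at_Arg) auto
  moreover have "Arg = (\<lambda>z. if z = 0 then 0 else g z)"
    unfolding g_def
  proof (rule ext)
    fix z :: complex
    show "Arg z = (if z = 0 then 0 else if z \<in> - \<real>\<^sub>\<le>\<^sub>0 then Arg z else pi)"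
    proof (cases "z = 0 \<or> z \<notin> \<real>\<^sub>\<le>\<^sub>0")
      case False
      then have "Re z < 0" "Im z = 0"
        by (auto simp: complex_nonpos_Reals_iff complex_eq_iff)
      with False Arg_eq_pi[of z] show ?thesis by simp
    qed (auto simp: Arg_zero)
  qed
  moreover have "(\<lambda>z. if z = 0 then 0 else g z) \<in> borel_measurable borel"
    using \<open>g \<in> borel_measurable borel\<close> by measurable
  ultimately show ?thesis by metis
qed

lemma Arg_cis_abs_le: "\<bar>Arg (cis t)\<bar> \<le> \<bar>t\<bar>"
proof (cases "-pi < t \<and> t \<le> pi")
  case True then show ?thesis by (simp add: Arg_cis)
next
  case False then show ?thesis using Arg_bounded[of "cis t"] by linarith
qed

lemma angular_dist_cis_le: "angular_dist (cis s) (cis t) \<le> \<bar>s - t\<bar>"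
  unfolding angular_dist_def cis_divide by (rule Arg_cis_abs_le)

lemma dist_cis: "dist (cis s) (cis t) = 2 * \<bar>sin ((s - t) / 2)\<bar>"
proof -
  have "cis s - cis t = cis t * (cis (s - t) - 1)"
    by (simp add: algebra_simps cis_mult)
  then have "dist (cis s) (cis t) = cmod (cis (s - t) - 1)"
    by (simp add: dist_norm norm_mult)
  then show ?thesis
    using dist_exp_i_1[of "s - t"] by (simp add: cis_conv_exp)
qed

lemma cis_Arg_circle: "z \<in> circle \<Longrightarrow> cis (Arg z) = z"
  by (subst cis_Arg) (auto simp: sgn_eq)

lemma dist_le_angular_dist:
  assumes "z \<in> circle" "w \<in> circle"
  shows "dist z w \<le> angular_dist z w"
proof -
  define t where "t = Arg (z / w)"
  have w: "w \<noteq> 0" and "z / w \<in> circle"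
    using assms by (auto simp: norm_divide)
  then have "z = cis t * w"
    using cis_Arg_circle[of "z / w"] by (simp add: t_def)
  then have "dist z w = dist (cis t) (cis 0)"
    using assms by (simp add: dist_norm norm_mult flip: left_diff_distrib[of "cis t" 1 w, simplified])
  also have "\<dots> \<le> \<bar>t\<bar>"
    unfolding dist_cis using abs_sin_x_le_abs_x[of "t/2"] by simp
  finally show ?thesis by (simp add: angular_dist_def t_def)
qed

lemma angular_dist_measurable [measurable]:
  "(\<lambda>p. angular_dist (fst p) (snd p)) \<in>
     borel_measurable (restrict_space borel circle \<Otimes>\<^sub>M restrict_space borel circle)"
proof -
  have [measurable]: "(\<lambda>z. z) \<in> measurable (restrict_space borel circle) (borel :: complex measure)"
    by (rule measurable_restrict_space1) simp
  have [measurable]: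
     "fst \<in> measurable (restrict_space borel circle \<Otimes>\<^sub>M restrict_space borel circle) (borel :: complex measure)"
     "snd \<in> measurable (restrict_space borel circle \<Otimes>\<^sub>M restrict_space borel circle) (borel :: complex measure)"
    by (auto intro: measurable_compose[OF measurable_fst] measurable_compose[OF measurable_snd])
  show ?thesis unfolding angular_dist_def by measurable
qed

lemma angular_dist_le_pi: "angular_dist z w \<le> pi"
  using Arg_bounded[of "z / w"] by (auto simp: angular_dist_def)

section \<open>Measures on the circle as laws of random angles\<close>

text \<open>
  Random angles on an arbitrary space represent measures on the circle: the parameter space is the
  unit interval in the convexity argument and the one of Skorohod's theorem in the compactness
  argument.
\<close>

definition angle_law :: "'a measure \<Rightarrow> ('a \<Rightarrow> real) \<Rightarrow> complex measure" where
  "angle_law \<Omega> X = distr \<Omega> (restrict_space borel circle) (\<lambda>\<omega>. cis (X \<omega>))"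

lemma cis_measurable [measurable]: "cis \<in> measurable borel (restrict_space borel circle)"
  by (intro measurable_restrict_space2 borel_measurable_continuous_onI continuous_intros) auto

lemma angle_law_circle_measures:
  assumes "prob_space \<Omega>" and [measurable]: "X \<in> borel_measurable \<Omega>"
  shows "angle_law \<Omega> X \<in> circle_measures"
  using prob_space.prob_space_distr[OF assms(1), of "\<lambda>\<omega>. cis (X \<omega>)" "restrict_space borel circle"]
  by (auto simp: angle_law_def circle_measures_def)

lemma Arg_measurable_circle_measure:
  assumes "\<mu> \<in> circle_measures"
  shows "Arg \<in> borel_measurable \<mu>"
  using assms measurable_restrict_space1[OF borel_measurable_Arg]
  by (auto simp: circle_measures_def cong: measurable_cong_sets)

lemma angle_law_Arg:
  assumes "\<mu> \<in> circle_measures"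
  shows "angle_law (distr \<mu> borel Arg) (\<lambda>x. x) = \<mu>"
proof -
  have sets: "sets \<mu> = sets (restrict_space borel circle)"
    using assms by (simp add: circle_measures_def)
  have space: "space \<mu> = circle"
    using sets_eq_imp_space_eq[OF sets] by (simp add: space_restrict_space)
  have "angle_law (distr \<mu> borel Arg) (\<lambda>x. x) = distr \<mu> (restrict_space borel circle) (cis \<circ> Arg)"
    unfolding angle_law_def by (intro distr_distr Arg_measurable_circle_measure assms) measurable
  also have "\<dots> = distr \<mu> \<mu> (\<lambda>z. z)"
    using sets by (intro distr_cong) (auto simp: space cis_Arg_circle)
  finally show ?thesis by (simp add: distr_id)
qed

lemma angle_law_cong_law:
  assumes [measurable]: "X \<in> borel_measurable \<Omega>" "Y \<in> borel_measurable \<Omega>'" 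
   and "distr \<Omega> borel X = distr \<Omega>' borel Y"
  shows "angle_law \<Omega> X = angle_law \<Omega>' Y"
proof -
  have *: "angle_law M Z = angle_law (distr M borel Z) (\<lambda>x. x)" 
    if [measurable]: "Z \<in> borel_measurable M" for M and Z :: "_ \<Rightarrow> real"
    unfolding angle_law_def by (simp add: distr_distr comp_def)
  show ?thesis using assms(3) *[of X \<Omega>] *[of Y \<Omega>'] by simp
qed

section \<open>The logarithmic energy of a random angle\<close>

text \<open>
  The value is \<open>- ln (\<bar>cis s - cis t\<bar> / 2)\<close> for \<open>x = s - t\<close>. Dividing the chord by the diameter makes
  the kernel nonnegative, so that its integrals exist in \<open>ennreal\<close> without integrability conditions.
\<close>

definition log_kernel :: "real \<Rightarrow> ennreal" where
  "log_kernel x = (if sin (x / 2) = 0 then \<top> else ennreal (- ln \<bar>sin (x / 2)\<bar>))"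

lemma log_kernel_measurable [measurable]: "log_kernel \<in> borel_measurable borel"
  unfolding log_kernel_def by measurable

lemma ln_abs_sin_le_0: "sin x \<noteq> 0 \<Longrightarrow> ln \<bar>sin x :: real\<bar> \<le> 0"
  by (simp add: abs_le_iff)

lemma log_dist_cis: "log_dist (cis s) (cis t) = ereal (ln 2) - enn2ereal (log_kernel (s - t))"
proof (cases "sin ((s - t) / 2) = 0")
  case True
  then have "cis s = cis t" using dist_cis[of s t] by simp
  with True show ?thesis by (simp add: log_dist_def log_kernel_def)
next
  case False
  then have "cis s \<noteq> cis t" using dist_cis[of s t] by auto
  moreover have "cmod (cis s - cis t) = 2 * \<bar>sin ((s - t) / 2)\<bar>"
    using dist_cis[of s t] by (simp add: dist_norm)
  ultimately show ?thesis
    using False ln_abs_sin_le_0[OF False]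
    by (simp add: log_dist_def log_kernel_def ln_mult enn2ereal_ennreal)
qed

definition log_energy :: "'a measure \<Rightarrow> ('a \<Rightarrow> real) \<Rightarrow> ennreal" where
  "log_energy \<Omega> X = (\<integral>\<^sup>+p. log_kernel (X (fst p) - X (snd p)) \<partial>(\<Omega> \<Otimes>\<^sub>M \<Omega>))"

text \<open>
  With \<open>p\<close> and \<open>n\<close> the positive and negative parts of \<open>c - g\<close>, truncated subtraction gives
  \<open>p + g = c + n\<close>. Integrating this and using \<open>p \<le> c\<close>, which makes the integral of \<open>p\<close> finite,
  identifies the difference of the two integrals even where \<open>g\<close> is infinite.
\<close>

lemma ereal_integral_const_minus:
  assumes "prob_space M" and [measurable]: "g \<in> borel_measurable M" and "c \<ge> 0"
    and f: "\<And>x. x \<in> space M \<Longrightarrow> f x = ereal c - enn2ereal (g x)"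
  shows "ereal_integral M f = ereal c - enn2ereal (\<integral>\<^sup>+x. g x \<partial>M)"
proof -
  interpret prob_space M by fact
  define p where "p = (\<lambda>x. ennreal c - g x)"
  define n where "n = (\<lambda>x. g x - ennreal c)"
  have [measurable]: "p \<in> borel_measurable M" "n \<in> borel_measurable M"
    unfolding p_def n_def by measurable
  have pn: "p x + g x = ennreal c + n x" for x
    unfolding p_def n_def
    by (cases "g x \<le> ennreal c")
      (auto simp: diff_add_cancel_ennreal add.commute[of "ennreal c"] diff_eq_0_iff_ennreal
         intro: order_le_less_trans ennreal_less_top)
  have fp: "(\<integral>\<^sup>+x. e2ennreal (f x) \<partial>M) = (\<integral>\<^sup>+x. p x \<partial>M)"
  proof (rule nn_integral_cong)
    fix x assume "x \<in> space M"
    then show "e2ennreal (f x) = p x"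
      using \<open>c \<ge> 0\<close>
      by (cases "g x") (simp_all add: f p_def ennreal_minus e2ennreal_neg)
  qed
  have fn: "(\<integral>\<^sup>+x. e2ennreal (- f x) \<partial>M) = (\<integral>\<^sup>+x. n x \<partial>M)"
  proof (rule nn_integral_cong)
    fix x assume "x \<in> space M"
    then show "e2ennreal (- f x) = n x"
      using \<open>c \<ge> 0\<close>
      by (cases "g x") (simp_all add: f n_def ennreal_minus e2ennreal_neg)
  qed
  have sum: "(\<integral>\<^sup>+x. p x \<partial>M) + (\<integral>\<^sup>+x. g x \<partial>M) = ennreal c + (\<integral>\<^sup>+x. n x \<partial>M)"
    by (simp add: pn emeasure_space_1 flip: nn_integral_add)
      (simp add: nn_integral_add emeasure_space_1)
  have "(\<integral>\<^sup>+x. p x \<partial>M) \<le> (\<integral>\<^sup>+x. ennreal c \<partial>M)"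
    by (intro nn_integral_mono) (simp add: p_def diff_le_self_ennreal)
  then have "(\<integral>\<^sup>+x. p x \<partial>M) \<le> ennreal c" by (simp add: emeasure_space_1)
  then show ?thesis
    unfolding ereal_integral_def fp fn using sum \<open>c \<ge> 0\<close>
    by (cases "\<integral>\<^sup>+x. p x \<partial>M"; cases "\<integral>\<^sup>+x. g x \<partial>M"; cases "\<integral>\<^sup>+x. n x \<partial>M") 
      (auto simp: ennreal_le_iff enn2ereal_ennreal top_unique simp flip: ennreal_plus)
qed

lemma free_entropy_angle_law:
  assumes "prob_space \<Omega>" and [measurable]: "X \<in> borel_measurable \<Omega>"
  shows "free_entropy (angle_law \<Omega> X) = ereal (ln 2) - enn2ereal (log_energy \<Omega> X)"
proof -
  interpret O: prob_space \<Omega> by fact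
  interpret OO: pair_prob_space \<Omega> \<Omega> ..
  let ?C = "restrict_space borel circle :: complex measure"
  define k where "k = (\<lambda>p. log_kernel (Arg (fst p) - Arg (snd p)))"
  have [measurable]: "Arg \<in> borel_measurable ?C"
    by (rule measurable_restrict_space1) simp
  have [measurable]: "k \<in> borel_measurable (?C \<Otimes>\<^sub>M ?C)"
    unfolding k_def by measurable
  have prob: "prob_space (angle_law \<Omega> X)"
    using angle_law_circle_measures[OF assms] by (simp add: circle_measures_def)
  interpret L: prob_space "angle_law \<Omega> X" by (rule prob)
  interpret LL: pair_prob_space "angle_law \<Omega> X" "angle_law \<Omega> X" ..
  have pair: "angle_law \<Omega> X \<Otimes>\<^sub>M angle_law \<Omega> X
      = distr (\<Omega> \<Otimes>\<^sub>M \<Omega>) (?C \<Otimes>\<^sub>M ?C) (\<lambda>(u, v). (cis (X u), cis (X v)))"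
    unfolding angle_law_def
    by (intro pair_measure_distr) (auto intro: L.sigma_finite_measure_axioms[unfolded angle_law_def])
  have dist_k: "log_dist z w = ereal (ln 2) - enn2ereal (k (z, w))" if "z \<in> circle" "w \<in> circle" for z w
    using log_dist_cis[of "Arg z" "Arg w"] that unfolding k_def by (simp only: cis_Arg_circle fst_conv snd_conv)
  have "free_entropy (angle_law \<Omega> X)
      = ereal (ln 2) - enn2ereal (\<integral>\<^sup>+p. k p \<partial>(angle_law \<Omega> X \<Otimes>\<^sub>M angle_law \<Omega> X))"
    unfolding free_entropy_def
  proof (rule ereal_integral_const_minus)
    show "k \<in> borel_measurable (angle_law \<Omega> X \<Otimes>\<^sub>M angle_law \<Omega> X)"
      unfolding pair by simp
    show "log_dist (fst p) (snd p) = ereal (ln 2) - enn2ereal (k p)"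
      if "p \<in> space (angle_law \<Omega> X \<Otimes>\<^sub>M angle_law \<Omega> X)" for p
      using that dist_k[of "fst p" "snd p"] unfolding pair
      by (auto simp: space_pair_measure space_restrict_space)
  qed (use LL.prob_space_axioms in auto)
  also have "(\<integral>\<^sup>+p. k p \<partial>(angle_law \<Omega> X \<Otimes>\<^sub>M angle_law \<Omega> X)) = log_energy \<Omega> X"
    unfolding pair log_energy_def
  proof (subst nn_integral_distr, simp, simp, rule nn_integral_cong)
    fix p
    have "enn2ereal (k (cis s, cis t)) = enn2ereal (log_kernel (s - t))" for s t
      using log_dist_cis[of s t] dist_k[of "cis s" "cis t"] 
      by (cases "k (cis s, cis t)"; cases "log_kernel (s - t)") auto
    then show "k (case p of (u, v) \<Rightarrow> (cis (X u), cis (X v))) = log_kernel (X (fst p) - X (snd p))"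
      by (auto split: prod.split simp: enn2ereal_inject)
  qed
  finally show ?thesis .
qed

section \<open>Strong convexity of the logarithmic energy\<close>

text \<open>
  The second derivative of \<open>- ln (sin (x / 2))\<close> is \<open>1 / (4 * (sin (x / 2))\<^sup>2)\<close>, hence at least
  \<open>1 / 4\<close>. This is the only source of convexity for the free entropy, and it is what allows
  \<open>\<rho>\<close> to be negative.
\<close>

lemma neg_ln_sin_half_convex:
  "convex_on {0<..<2*pi} (\<lambda>x. - ln (sin (x / 2)) - x\<^sup>2 / 8)"
proof (rule f''_ge0_imp_convex)
  fix x :: real assume x: "x \<in> {0<..<2*pi}"
  then have pos: "sin (x / 2) > 0" by (intro sin_gt_zero) auto
  show "((\<lambda>x. - ln (sin (x / 2)) - x\<^sup>2 / 8) has_real_derivative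
      (- cos (x / 2) / (2 * sin (x / 2)) - x / 4)) (at x)"
    using pos by (auto intro!: derivative_eq_intros simp: field_simps)
  show "((\<lambda>x. - cos (x / 2) / (2 * sin (x / 2)) - x / 4) has_real_derivative
      (1 / (4 * (sin (x / 2))\<^sup>2) - 1 / 4)) (at x)"
  proof -
    have "((\<lambda>x. - cos (x / 2) / (2 * sin (x / 2)) - x / 4) has_real_derivative
      (sin (x / 2) / 2 * (2 * sin (x / 2)) - (- cos (x / 2)) * cos (x / 2)) /
        ((2 * sin (x / 2)) * (2 * sin (x / 2))) - 1 / 4) (at x)"
      using pos by (auto intro!: derivative_eq_intros simp: field_simps)
    moreover have "sin (x / 2) / 2 * (2 * sin (x / 2)) - (- cos (x / 2)) * cos (x / 2) = 1"
      using sin_cos_squared_add[of "x / 2"] by (simp add: power2_eq_square)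
    ultimately show ?thesis
      by (simp only:) (simp add: power2_eq_square)
  qed
  have "(sin (x / 2))\<^sup>2 \<le> 1" by (simp add: abs_square_le_1)
  then show "0 \<le> 1 / (4 * (sin (x / 2))\<^sup>2) - 1 / 4"
    using pos by (simp add: field_simps)
qed auto

lemma log_kernel_commute: "log_kernel (x - y) = log_kernel (y - x)"
proof -
  have "sin ((x - y) / 2) = - sin ((y - x) / 2)"
    by (simp flip: sin_minus add: minus_divide_left)
  then show ?thesis by (simp add: log_kernel_def)
qed

text \<open>
  At the ends of \<open>[0, 2 * pi]\<close> the kernel is infinite, so the convexity inequality extends from the
  open interval to the closed one. The closed interval is needed since lifts of measures with atoms
  are constant on intervals.
\<close>

lemma log_kernel_strongly_convex:
  assumes a: "0 \<le> a" "a \<le> 2 * pi" and b: "0 \<le> b" "b \<le> 2 * pi" and s: "0 < s" "s < 1"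
  shows "log_kernel ((1 - s) * a + s * b) + ennreal (s * (1 - s) / 8 * (b - a)\<^sup>2)
    \<le> ennreal (1 - s) * log_kernel a + ennreal s * log_kernel b"
proof (cases "0 < a \<and> a < 2 * pi \<and> 0 < b \<and> b < 2 * pi")
  case True
  define c where "c = (1 - s) * a + s * b"
  have c: "0 < c" "c < 2 * pi"
    using convexD_alt[of "{0<..<2*pi}" a b s] True s by (auto simp: c_def)
  have fin: "log_kernel x = ennreal (- ln (sin (x / 2)))" "- ln (sin (x / 2)) \<ge> 0"
    if "0 < x" "x < 2 * pi" for x
  proof -
    have "sin (x / 2) > 0" using that by (intro sin_gt_zero) auto
    then show "log_kernel x = ennreal (- ln (sin (x / 2)))" "- ln (sin (x / 2)) \<ge> 0"
      by (auto simp: log_kernel_def)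
  qed
  have "- ln (sin (c / 2)) - c\<^sup>2 / 8
      \<le> (1 - s) * (- ln (sin (a / 2)) - a\<^sup>2 / 8) + s * (- ln (sin (b / 2)) - b\<^sup>2 / 8)"
    using convex_onD[OF neg_ln_sin_half_convex, of s a b] True s by (simp add: c_def)
  moreover have "(1 - s) * a\<^sup>2 + s * b\<^sup>2 - c\<^sup>2 = s * (1 - s) * (b - a)\<^sup>2"
    unfolding c_def by (simp add: power2_eq_square algebra_simps)
  ultimately have "- ln (sin (c / 2)) + s * (1 - s) / 8 * (b - a)\<^sup>2
      \<le> (1 - s) * (- ln (sin (a / 2))) + s * (- ln (sin (b / 2)))"
    by argo
  then have "ennreal (- ln (sin (c / 2)) + s * (1 - s) / 8 * (b - a)\<^sup>2)
      \<le> ennreal ((1 - s) * (- ln (sin (a / 2))) + s * (- ln (sin (b / 2))))"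
    by (rule ennreal_leI)
  moreover have "log_kernel c + ennreal (s * (1 - s) / 8 * (b - a)\<^sup>2)
      = ennreal (- ln (sin (c / 2)) + s * (1 - s) / 8 * (b - a)\<^sup>2)"
    using fin[OF c] s by (subst ennreal_plus) auto
  moreover have "ennreal (1 - s) * log_kernel a + ennreal s * log_kernel b
      = ennreal ((1 - s) * (- ln (sin (a / 2))) + s * (- ln (sin (b / 2))))"
    using fin[of a] fin[of b] True s
    by (subst ennreal_plus) (auto simp: mult_nonneg_nonpos simp flip: ennreal_mult)
  ultimately show ?thesis by (simp only: c_def)
next
  case False
  then have "log_kernel a = \<top> \<or> log_kernel b = \<top>"
    using a b by (auto simp: log_kernel_def)
  then show ?thesis
    using s by (auto simp: ennreal_mult_top)
qed

abbreviation unit_uniform :: "real measure" where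
  "unit_uniform \<equiv> restrict_space lborel {0<..<1}"

lemma prob_space_unit_uniform: "prob_space unit_uniform"
  by (rule prob_spaceI) (simp add: space_restrict_space emeasure_restrict_space)

interpretation unit_uniform: prob_space unit_uniform
  by (rule prob_space_unit_uniform)

lemma measure_unit_uniform [simp]: "measure unit_uniform {0<..<1} = 1"
  by (simp add: measure_restrict_space)

interpretation unit_square: pair_prob_space unit_uniform unit_uniform ..

text \<open>
  The lifts to the real line of monotone, possibly discontinuous, maps of degree one from the
  parameter circle, of length 1, to the unit circle. Working on all of \<open>real\<close> rather than on one period makes rotations of the
  parameter translations.
\<close>

definition degree_one_lift :: "(real \<Rightarrow> real) \<Rightarrow> bool" where
  "degree_one_lift X \<longleftrightarrow> mono X \<and> (\<forall>u. X (u + 1) = X u + 2 * pi)"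

lemma degree_one_lift_convex:
  assumes "degree_one_lift X" "degree_one_lift Y" "0 \<le> s" "s \<le> 1"
  shows "degree_one_lift (\<lambda>u. (1 - s) * X u + s * Y u)"
  unfolding degree_one_lift_def
proof (intro conjI allI monoI)
  fix u v :: real assume "u \<le> v"
  with assms show "(1 - s) * X u + s * Y u \<le> (1 - s) * X v + s * Y v"
    by (intro add_mono mult_left_mono) (auto simp: degree_one_lift_def monoD)
next
  fix u
  have "X (u + 1) = X u + 2 * pi" "Y (u + 1) = Y u + 2 * pi"
    using assms by (auto simp: degree_one_lift_def)
  then show "(1 - s) * X (u + 1) + s * Y (u + 1) = (1 - s) * X u + s * Y u + 2 * pi"
    by (simp add: algebra_simps)
qed

lemma degree_one_lift_measurable:
  assumes "degree_one_lift X"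
  shows "X \<in> borel_measurable unit_uniform"
proof -
  have "X \<in> borel_measurable borel"
    using assms borel_measurable_mono unfolding degree_one_lift_def by blast
  then have "X \<in> borel_measurable lborel" by simp
  then show ?thesis by (rule measurable_restrict_space1)
qed

lemma degree_one_lift_oscillation:
  assumes "degree_one_lift X" "u \<le> v" "v \<le> u + 1"
  shows "0 \<le> X v - X u" "X v - X u \<le> 2 * pi"
proof -
  have mono: "mono X" and period: "X (u + 1) = X u + 2 * pi"
    using assms(1) by (auto simp: degree_one_lift_def)
  show "0 \<le> X v - X u" "X v - X u \<le> 2 * pi"
    using monoD[OF mono assms(2)] monoD[OF mono assms(3)] period by auto
qed

lemma degree_one_lift_bounded:
  assumes "degree_one_lift X" "u \<in> space unit_uniform"
  shows "\<bar>X u\<bar> \<le> \<bar>X 0\<bar> + 2 * pi"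
proof -
  have "0 \<le> u" "u \<le> 0 + 1"
    using assms(2) by (simp_all add: space_restrict_space)
  from degree_one_lift_oscillation[OF assms(1) this] show ?thesis
    by arith
qed

lemma degree_one_lift_integrable:
  assumes "degree_one_lift X"
  shows "integrable unit_uniform X"
proof (rule unit_uniform.integrable_const_bound)
  show "AE u in unit_uniform. norm (X u) \<le> \<bar>X 0\<bar> + 2 * pi"
    by (rule AE_I2) (simp only: real_norm_def degree_one_lift_bounded[OF assms])
qed (rule degree_one_lift_measurable[OF assms])

text \<open>
  Apply the pointwise convexity to \<open>X u - X v\<close> and \<open>Y u - Y v\<close>, both in \<open>[0, 2 * pi]\<close> for \<open>v \<le> u\<close>,
  and use symmetry for \<open>u \<le> v\<close>. The defect is \<open>s * (1 - s) / 8\<close> times the double integral of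
  \<open>(D u - D v)\<^sup>2\<close>, where \<open>D = Y - X\<close>; that integral is twice the variance of \<open>D\<close>. A common
  rotation of the circle is invisible to the energy, and the mean condition excludes it.
\<close>

lemma log_energy_strongly_convex:
  assumes X: "degree_one_lift X" and Y: "degree_one_lift Y" and s: "0 < s" "s < 1"
    and mean: "(\<integral>u. Y u - X u \<partial>unit_uniform) = 0"
  shows "log_energy unit_uniform (\<lambda>u. (1 - s) * X u + s * Y u)
      + ennreal (s * (1 - s) / 4 * (\<integral>u. (Y u - X u)\<^sup>2 \<partial>unit_uniform))
    \<le> ennreal (1 - s) * log_energy unit_uniform X + ennreal s * log_energy unit_uniform Y"
proof -
  let ?UU = "unit_uniform \<Otimes>\<^sub>M unit_uniform"
  define D where "D = (\<lambda>u. Y u - X u)"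
  note [measurable] = degree_one_lift_measurable[OF X] degree_one_lift_measurable[OF Y]
  have [measurable]: "D \<in> borel_measurable unit_uniform" unfolding D_def by measurable
  define B where "B = \<bar>X 0\<bar> + 2 * pi + (\<bar>Y 0\<bar> + 2 * pi)"
  have B: "\<bar>D u\<bar> \<le> B" if "u \<in> space unit_uniform" for u
    using degree_one_lift_bounded[OF X that] degree_one_lift_bounded[OF Y that]
    by (simp add: D_def B_def)
  have "B \<ge> 0" by (simp add: B_def)
  have intf: "integrable ?UU (\<lambda>p. (D (fst p))\<^sup>2)" and ints: "integrable ?UU (\<lambda>p. (D (snd p))\<^sup>2)"
    using power_mono[OF B, of _ 2]
    by (auto intro!: unit_square.integrable_const_bound[where B = "B\<^sup>2"] AE_I2 simp: space_pair_measure)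
  have intp: "integrable ?UU (\<lambda>p. D (fst p) * D (snd p))"
    using \<open>B \<ge> 0\<close>
    by (intro unit_square.integrable_const_bound[where B = "B * B"] AE_I2)
      (auto simp: space_pair_measure abs_mult intro!: mult_mono B)
  \<comment> \<open>The cross term is the square of the mean of D, which vanishes.\<close>
  have "(\<integral>p. (D (fst p) - D (snd p))\<^sup>2 \<partial>?UU)
     = (\<integral>p. (D (fst p))\<^sup>2 + (D (snd p))\<^sup>2 - 2 * (D (fst p) * D (snd p)) \<partial>?UU)"
    by (simp add: power2_diff mult.assoc)
  also have "\<dots> = (\<integral>p. (D (fst p))\<^sup>2 \<partial>?UU) + (\<integral>p. (D (snd p))\<^sup>2 \<partial>?UU)
      - 2 * (\<integral>p. D (fst p) * D (snd p) \<partial>?UU)"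
    using intf ints intp by simp
  also have "(\<integral>p. (D (fst p))\<^sup>2 \<partial>?UU) = (\<integral>u. (D u)\<^sup>2 \<partial>unit_uniform)"
    using unit_square.integral_fst'[OF intf] by (simp add: unit_uniform.prob_space)
  also have "(\<integral>p. (D (snd p))\<^sup>2 \<partial>?UU) = (\<integral>u. (D u)\<^sup>2 \<partial>unit_uniform)"
    using unit_square.integral_fst'[OF ints] by (simp add: unit_uniform.prob_space)
  also have "(\<integral>p. D (fst p) * D (snd p) \<partial>?UU) = 0"
    using unit_square.integral_fst'[OF intp] mean by (simp flip: D_def)
  finally have var: "(\<integral>p. (D (fst p) - D (snd p))\<^sup>2 \<partial>?UU) = 2 * (\<integral>u. (D u)\<^sup>2 \<partial>unit_uniform)"
    by simp
  have intd: "integrable ?UU (\<lambda>p. s * (1 - s) / 8 * (D (fst p) - D (snd p))\<^sup>2)"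
    using intf ints intp by (simp add: power2_diff mult.assoc)
  have gap: "(\<integral>\<^sup>+p. ennreal (s * (1 - s) / 8 * (D (fst p) - D (snd p))\<^sup>2) \<partial>?UU)
    = ennreal (s * (1 - s) / 4 * (\<integral>u. (D u)\<^sup>2 \<partial>unit_uniform))"
    using s by (subst nn_integral_eq_integral[OF intd]) (auto simp: var)
  have pointwise: "log_kernel ((1 - s) * X u + s * Y u - ((1 - s) * X v + s * Y v))
        + ennreal (s * (1 - s) / 8 * (D u - D v)\<^sup>2)
      \<le> ennreal (1 - s) * log_kernel (X u - X v) + ennreal s * log_kernel (Y u - Y v)"
    if "u \<in> space unit_uniform" "v \<in> space unit_uniform" for u v
  proof -
    have *: "log_kernel ((1 - s) * X u + s * Y u - ((1 - s) * X v + s * Y v))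
        + ennreal (s * (1 - s) / 8 * (D u - D v)\<^sup>2)
      \<le> ennreal (1 - s) * log_kernel (X u - X v) + ennreal s * log_kernel (Y u - Y v)"
      if "v \<le> u" "u \<le> v + 1" for u v
      using log_kernel_strongly_convex[of "X u - X v" "Y u - Y v" s] s
        degree_one_lift_oscillation[OF X that] degree_one_lift_oscillation[OF Y that]
      by (simp add: D_def algebra_simps)
    show ?thesis
    proof (cases "v \<le> u")
      case True
      then show ?thesis using * that by (auto simp: space_restrict_space)
    next
      case False
      then have "log_kernel ((1 - s) * X v + s * Y v - ((1 - s) * X u + s * Y u))
        + ennreal (s * (1 - s) / 8 * (D v - D u)\<^sup>2)
      \<le> ennreal (1 - s) * log_kernel (X v - X u) + ennreal s * log_kernel (Y v - Y u)"
        using *[of u v] that by (auto simp: space_restrict_space)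
      then show ?thesis
        unfolding log_kernel_commute[of "X u" "X v"] log_kernel_commute[of "Y u" "Y v"]
          log_kernel_commute[of "(1 - s) * X u + s * Y u" "(1 - s) * X v + s * Y v"]
          power2_commute[of "D u" "D v"] .
    qed
  qed
  have "log_energy unit_uniform (\<lambda>u. (1 - s) * X u + s * Y u)
      + ennreal (s * (1 - s) / 4 * (\<integral>u. (Y u - X u)\<^sup>2 \<partial>unit_uniform))
    = (\<integral>\<^sup>+p. log_kernel ((1 - s) * X (fst p) + s * Y (fst p) - ((1 - s) * X (snd p) + s * Y (snd p)))
        + ennreal (s * (1 - s) / 8 * (D (fst p) - D (snd p))\<^sup>2) \<partial>?UU)"
    unfolding log_energy_def gap[unfolded D_def, symmetric] D_def by (rule nn_integral_add[symmetric]) measurable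
  also have "\<dots> \<le> (\<integral>\<^sup>+p. ennreal (1 - s) * log_kernel (X (fst p) - X (snd p))
        + ennreal s * log_kernel (Y (fst p) - Y (snd p)) \<partial>?UU)"
  proof (rule nn_integral_mono)
    fix p assume "p \<in> space ?UU"
    then have "fst p \<in> space unit_uniform" "snd p \<in> space unit_uniform"
      unfolding space_pair_measure by auto
    from pointwise[OF this]
    show "log_kernel ((1 - s) * X (fst p) + s * Y (fst p) - ((1 - s) * X (snd p) + s * Y (snd p)))
          + ennreal (s * (1 - s) / 8 * (D (fst p) - D (snd p))\<^sup>2)
        \<le> ennreal (1 - s) * log_kernel (X (fst p) - X (snd p))
          + ennreal s * log_kernel (Y (fst p) - Y (snd p))" .
  qed
  also have "\<dots> = ennreal (1 - s) * log_energy unit_uniform X + ennreal s * log_energy unit_uniform Y"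
    unfolding log_energy_def by (subst nn_integral_add) (auto simp: nn_integral_cmult)
  finally show ?thesis .
qed

section \<open>The potential\<close>

text \<open>
  Convexity controls \<open>Q\<close> only through the lifted function \<open>Q (cis t)\<close>; the argument
  function transfers its continuity back to measurability and boundedness on the circle.
\<close>

lemma potential_measurable:
  assumes "continuous_on UNIV (\<lambda>t. Q (cis t))"
  shows "Q \<in> borel_measurable (restrict_space borel circle)"
proof -
  have [measurable]: "Arg \<in> borel_measurable (restrict_space borel circle)"
    by (rule measurable_restrict_space1) simp
  have "(\<lambda>t. Q (cis t)) \<in> borel_measurable borel"
    using assms by (rule borel_measurable_continuous_onI)
  then have "(\<lambda>z. Q (cis (Arg z))) \<in> borel_measurable (restrict_space borel circle)"
    by measurable
  moreover have "Q (cis (Arg z)) = Q z" if "z \<in> space (restrict_space borel circle)" for z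
    using that by (simp add: space_restrict_space cis_Arg_circle)
  ultimately show ?thesis
    using measurable_cong[of "restrict_space borel circle" "\<lambda>z. Q (cis (Arg z))" Q borel] by blast
qed

lemma potential_bounded:
  fixes Q :: "complex \<Rightarrow> real"
  assumes "continuous_on UNIV (\<lambda>t. Q (cis t))"
  obtains C where "\<And>t. \<bar>Q (cis t)\<bar> \<le> C"
proof -
  have "compact ((\<lambda>t. Q (cis t)) ` {-pi..pi})"
    using continuous_on_subset[OF assms] by (intro compact_continuous_image) auto
  then obtain C where "\<forall>x \<in> (\<lambda>t. Q (cis t)) ` {-pi..pi}. norm x \<le> C"
    using compact_imp_bounded bounded_iff by metis
  then have C: "\<And>t. t \<in> {-pi..pi} \<Longrightarrow> \<bar>Q (cis t)\<bar> \<le> C" by simp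
  have "\<bar>Q (cis t)\<bar> \<le> C" for t
    using C[of "Arg (cis t)"] Arg_bounded[of "cis t"] by (simp add: cis_Arg_circle less_imp_le)
  then show ?thesis using that by blast
qed

lemma integral_angle_law:
  fixes Q :: "complex \<Rightarrow> real"
  assumes "continuous_on UNIV (\<lambda>t. Q (cis t))" and [measurable]: "X \<in> borel_measurable \<Omega>"
  shows "(\<integral>z. Q z \<partial>angle_law \<Omega> X) = (\<integral>\<omega>. Q (cis (X \<omega>)) \<partial>\<Omega>)"
  unfolding angle_law_def by (rule integral_distr) (auto intro: potential_measurable assms)

lemma integrable_potential:
  fixes Q :: "complex \<Rightarrow> real"
  assumes "continuous_on UNIV (\<lambda>t. Q (cis t))" "prob_space \<Omega>" and [measurable]: "X \<in> borel_measurable \<Omega>"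
  shows "integrable \<Omega> (\<lambda>\<omega>. Q (cis (X \<omega>)))"
proof -
  interpret prob_space \<Omega> by fact
  have [measurable]: "(\<lambda>t. Q (cis t)) \<in> borel_measurable borel"
    using assms(1) by (rule borel_measurable_continuous_onI)
  from potential_bounded[OF assms(1)] obtain C where C: "\<And>t. \<bar>Q (cis t)\<bar> \<le> C" by blast
  show ?thesis
    by (rule integrable_const_bound[where B = C]) (auto intro: C)
qed

section \<open>Every measure on the circle has a centred lift\<close>

text \<open>
  Rotation invariance of the uniform law: for \<open>r = frac c\<close> the rotation translates \<open>(0, 1 - r)\<close> onto
  \<open>(r, 1)\<close> and \<open>[1 - r, 1)\<close> onto \<open>[0, r)\<close>. The two images are disjoint and fill \<open>(0, 1)\<close> up to the null set
  \<open>{0, r}\<close>.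
\<close>

lemma distr_frac_unit_uniform:
  "distr unit_uniform borel (\<lambda>u. frac (u + c)) = distr unit_uniform borel (\<lambda>u. u)"
proof (rule measure_eqI)
  have [measurable]: "frac \<in> borel_measurable (borel :: real measure)"
    unfolding frac_def by measurable
  have [measurable]: "(\<lambda>u. u) \<in> borel_measurable unit_uniform"
    by (rule measurable_restrict_space1) simp
  fix A :: "real set"
  assume "A \<in> sets (distr unit_uniform borel (\<lambda>u. frac (u + c)))"
  then have [measurable]: "A \<in> sets borel" by simp
  define r where "r = frac c"
  have r: "0 \<le> r" "r < 1" by (auto simp: r_def frac_lt_1)
  have frac: "frac (u + c) = (if u + r < 1 then u + r else u + r - 1)" if "0 < u" "u < 1" for u
    using that r frac_add[of u c] by (simp add: r_def frac_eq[THEN iffD2])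
  have em: "emeasure (distr unit_uniform borel f) A = (\<integral>\<^sup>+u. indicator A (f u) * indicator {0<..<1} u \<partial>lborel)"
    if [measurable]: "f \<in> borel_measurable borel" for f
  proof -
    have [measurable]: "f \<in> borel_measurable unit_uniform"
      by (rule measurable_restrict_space1) simp
    have "emeasure (distr unit_uniform borel f) A = (\<integral>\<^sup>+x. indicator A x \<partial>distr unit_uniform borel f)"
      by simp
    also have "\<dots> = (\<integral>\<^sup>+u. indicator A (f u) \<partial>unit_uniform)"
      by (rule nn_integral_distr) auto
    finally show ?thesis by (simp add: nn_integral_restrict_space)
  qed
  have "emeasure (distr unit_uniform borel (\<lambda>u. frac (u + c))) A
     = (\<integral>\<^sup>+u. indicator A (frac (u + c)) * indicator {0<..<1} u \<partial>lborel)"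
    by (rule em) measurable
  also have "\<dots> = (\<integral>\<^sup>+u. indicator (A \<inter> {r<..<1}) (r + 1 * u)
      + indicator (A \<inter> {0..<r}) ((r - 1) + 1 * u) \<partial>lborel)"
  proof (rule nn_integral_cong)
    fix u :: real
    consider "0 < u" "u < 1" | "u \<le> 0" | "1 \<le> u" by linarith
    then show "indicator A (frac (u + c)) * indicator {0<..<1} u
      = (indicator (A \<inter> {r<..<1}) (r + 1 * u) + indicator (A \<inter> {0..<r}) ((r - 1) + 1 * u) :: ennreal)"
    proof cases
      case 1
      then show ?thesis using frac[OF 1] r by (auto simp: indicator_def algebra_simps)
    qed (use r in \<open>auto simp: indicator_def\<close>)
  qed
  also have "\<dots> = (\<integral>\<^sup>+u. indicator (A \<inter> {r<..<1}) u \<partial>lborel) + (\<integral>\<^sup>+u. indicator (A \<inter> {0..<r}) u \<partial>lborel)"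
    using nn_integral_real_affine[of "indicator (A \<inter> {r<..<1})" 1 r]
      nn_integral_real_affine[of "indicator (A \<inter> {0..<r})" 1 "r - 1"]
    by (subst nn_integral_add) (auto simp del: nn_integral_indicator)
  also have "\<dots> = (\<integral>\<^sup>+u. indicator (A \<inter> {r<..<1}) u + indicator (A \<inter> {0..<r}) u \<partial>lborel)"
    by (rule nn_integral_add[symmetric]) auto
  also have "\<dots> = (\<integral>\<^sup>+u. indicator A u * indicator {0<..<1} u \<partial>lborel)"
  proof (rule nn_integral_cong_AE)
    show "AE u in lborel. indicator (A \<inter> {r<..<1}) u + indicator (A \<inter> {0..<r}) u
        = (indicator A u * indicator {0<..<1} u :: ennreal)"
      using AE_lborel_singleton[of r] AE_lborel_singleton[of 0]
      by eventually_elim (use r in \<open>auto simp: indicator_def\<close>)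
  qed
  also have "\<dots> = emeasure (distr unit_uniform borel (\<lambda>u. u)) A"
    by (rule em[symmetric]) simp
  finally show "emeasure (distr unit_uniform borel (\<lambda>u. frac (u + c))) A
      = emeasure (distr unit_uniform borel (\<lambda>u. u)) A" .
qed simp

lemma real_distribution_Arg:
  assumes "\<mu> \<in> circle_measures"
  shows "real_distribution (distr \<mu> borel Arg)"
  using assms prob_space.real_distribution_distr[OF _ Arg_measurable_circle_measure[OF assms]]
  by (simp add: circle_measures_def)

text \<open>
  The values of \<open>G\<close> on one period spread over at most \<open>2 * pi\<close>, the amount added at each integer, so
  the quasi-periodic extension does not decrease there either.
\<close>

lemma degree_one_lift_extend:
  assumes mono: "\<And>x y. 0 \<le> x \<Longrightarrow> x \<le> y \<Longrightarrow> y < 1 \<Longrightarrow> G x \<le> G y"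
    and bounds: "\<And>x. 0 \<le> x \<Longrightarrow> x < 1 \<Longrightarrow> G x \<in> {-pi..pi}"
  shows "degree_one_lift (\<lambda>u. G (frac (u + c)) + 2 * pi * of_int \<lfloor>u + c\<rfloor>)"
  unfolding degree_one_lift_def
proof (intro conjI allI monoI)
  fix u v :: real assume uv: "u \<le> v"
  have bnd: "G (frac t) \<in> {-pi..pi}" for t
    by (rule bounds) (auto simp: frac_lt_1)
  consider "\<lfloor>u + c\<rfloor> = \<lfloor>v + c\<rfloor>" | "\<lfloor>u + c\<rfloor> + 1 \<le> \<lfloor>v + c\<rfloor>"
    using floor_mono[of "u + c" "v + c"] uv by linarith
  then show "G (frac (u + c)) + 2 * pi * of_int \<lfloor>u + c\<rfloor> \<le> G (frac (v + c)) + 2 * pi * of_int \<lfloor>v + c\<rfloor>"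
  proof cases
    case 1
    then show ?thesis using uv by (auto intro!: mono simp: frac_lt_1) (simp add: frac_def)
  next
    case 2
    then have "of_int \<lfloor>u + c\<rfloor> + 1 \<le> (of_int \<lfloor>v + c\<rfloor> :: real)" by linarith
    from mult_left_mono[OF this, of "2 * pi"] show ?thesis
      using bnd[of "u + c"] bnd[of "v + c"] by (auto simp: algebra_simps)
  qed
next
  fix u
  have "u + 1 + c = (u + c) + 1" by simp
  then show "G (frac (u + 1 + c)) + 2 * pi * of_int \<lfloor>u + 1 + c\<rfloor>
      = G (frac (u + c)) + 2 * pi * of_int \<lfloor>u + c\<rfloor> + 2 * pi"
    by (simp only: frac_1_eq) (simp add: algebra_simps)
qed

text \<open>
  The quantile function of the argument. Outside \<open>(0, 1)\<close> it is given its lower bound \<open>- pi\<close>, which keeps it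
  monotone on \<open>[0, 1)\<close>.
\<close>

lemma circle_measure_quantile:
  assumes "\<mu> \<in> circle_measures"
  obtains G :: "real \<Rightarrow> real" where
    "\<And>x y. 0 \<le> x \<Longrightarrow> x \<le> y \<Longrightarrow> y < 1 \<Longrightarrow> G x \<le> G y"
    "\<And>x. G x \<in> {-pi..pi}"
    "G \<in> borel_measurable borel"
    "distr unit_uniform borel G = distr \<mu> borel Arg"
proof -
  define M where "M = distr \<mu> borel Arg"
  interpret M: cdf_distribution M
    using real_distribution_Arg[OF assms] by (simp add: M_def cdf_distribution_def)
  have Arg: "Arg \<in> borel_measurable \<mu>" by (rule Arg_measurable_circle_measure[OF assms])
  have prob: "prob_space \<mu>" using assms by (simp add: circle_measures_def)
  have top: "cdf M pi = 1"
  proof -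
    have "Arg -` {..pi} \<inter> space \<mu> = space \<mu>" using Arg_bounded by auto
    then show ?thesis
      unfolding cdf_def M_def by (subst measure_distr[OF Arg]) (auto simp: prob_space.prob_space[OF prob])
  qed
  have bot: "cdf M (- pi) = 0"
  proof -
    have "\<not> Arg z \<le> - pi" for z using Arg_bounded[of z] by linarith
    then have "Arg -` {..-pi} \<inter> space \<mu> = {}" by auto
    then show ?thesis
      unfolding cdf_def M_def by (subst measure_distr[OF Arg]) auto
  qed
  have I_bounds: "- pi < M.I u" "M.I u \<le> pi" if "u \<in> {0<..<1}" for u
    using M.pseudoinverse'[rule_format, OF that, of pi] M.pseudoinverse'[rule_format, OF that, of "- pi"]
      that top bot by auto
  define G where "G = (\<lambda>u. if u \<in> {0<..<1} then M.I u else - pi)"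
  show ?thesis
  proof (rule that)
    show "G x \<le> G y" if "0 \<le> x" "x \<le> y" "y < 1" for x y
      using that I_bounds[of y] M.mono_I by (auto simp: G_def mono_on_def)
    show "G x \<in> {-pi..pi}" for x
      using I_bounds[of x] by (auto simp: G_def)
    show "G \<in> borel_measurable borel"
      unfolding G_def
      by (subst measurable_If_restrict_space_iff) (use M.measurable_CI in \<open>simp_all del: greaterThanLessThan_iff\<close>)
    have "distr unit_uniform borel G = distr unit_uniform borel M.I"
      by (rule distr_cong) (auto simp: G_def space_restrict_space)
    then show "distr unit_uniform borel G = distr \<mu> borel Arg"
      using M.distr_I_eq_M by (simp add: M_def)
  qed
qed

text \<open>
  For the quasi-periodic extension of the quantile function \<open>G\<close>, rotating the parameter by \<open>c\<close> preserves the law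
  on the circle by rotation invariance. It changes the mean by \<open>2 * pi\<close> times the mean of
  \<open>\<lfloor>u + c\<rfloor> = u + c - frac (u + c)\<close>, which is \<open>c\<close> by rotation invariance again. So one explicit
  choice of \<open>c\<close> makes the mean zero.
\<close>

lemma circle_measure_centred_lift:
  assumes "\<mu> \<in> circle_measures"
  obtains X where "degree_one_lift X" "angle_law unit_uniform X = \<mu>" "(\<integral>u. X u \<partial>unit_uniform) = 0"
proof -
  obtain G :: "real \<Rightarrow> real" where mono: "\<And>x y. 0 \<le> x \<Longrightarrow> x \<le> y \<Longrightarrow> y < 1 \<Longrightarrow> G x \<le> G y"
    and bnd: "\<And>x. G x \<in> {-pi..pi}" and [measurable]: "G \<in> borel_measurable borel"
    and law: "distr unit_uniform borel G = distr \<mu> borel Arg"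
    using circle_measure_quantile[OF assms] by blast
  define c where "c = - (\<integral>u. G u \<partial>unit_uniform) / (2 * pi)"
  define X where "X = (\<lambda>u. G (frac (u + c)) + 2 * pi * of_int \<lfloor>u + c\<rfloor>)"
  have [measurable]: "frac \<in> borel_measurable (borel :: real measure)"
    unfolding frac_def by measurable
  have id [measurable]: "(\<lambda>u. u) \<in> borel_measurable unit_uniform"
    by (rule measurable_restrict_space1) simp
  have lift: "degree_one_lift X"
    unfolding X_def by (rule degree_one_lift_extend[OF mono bnd])
  note [measurable] = degree_one_lift_measurable[OF lift]
  have Gm [measurable]: "G \<in> borel_measurable unit_uniform"
    by (rule measurable_restrict_space1) simp
  have law': "distr unit_uniform borel (\<lambda>u. G (frac (u + c))) = distr \<mu> borel Arg"
  proof -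
    have "distr unit_uniform borel (\<lambda>u. G (frac (u + c)))
        = distr (distr unit_uniform borel (\<lambda>u. frac (u + c))) borel G"
      by (simp add: distr_distr comp_def)
    also have "\<dots> = distr unit_uniform borel G"
      unfolding distr_frac_unit_uniform by (simp add: distr_distr comp_def)
    finally show ?thesis using law by simp
  qed
  have "cis (X u) = cis (G (frac (u + c)))" for u
    unfolding X_def by (simp flip: cis_mult)
  then have "angle_law unit_uniform X = angle_law unit_uniform (\<lambda>u. G (frac (u + c)))"
    by (simp add: angle_law_def)
  also have "\<dots> = angle_law (distr \<mu> borel Arg) (\<lambda>x. x)"
    by (rule angle_law_cong_law) (auto simp: law' distr_id2)
  also have "\<dots> = \<mu>" by (rule angle_law_Arg[OF assms])
  finally have "angle_law unit_uniform X = \<mu>" .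
  moreover have "(\<integral>u. X u \<partial>unit_uniform) = 0"
  proof -
    have rot: "(\<integral>u. h (frac (u + c)) \<partial>unit_uniform) = (\<integral>u. h u \<partial>unit_uniform)"
      if [measurable]: "h \<in> borel_measurable borel" for h :: "real \<Rightarrow> real"
    proof -
      have "(\<integral>u. h (frac (u + c)) \<partial>unit_uniform) = (\<integral>x. h x \<partial>distr unit_uniform borel (\<lambda>u. frac (u + c)))"
        by (rule integral_distr[symmetric]) auto
      also have "\<dots> = (\<integral>u. h u \<partial>unit_uniform)"
        unfolding distr_frac_unit_uniform by (rule integral_distr) auto
      finally show ?thesis .
    qed
    have i1: "integrable unit_uniform (\<lambda>u. G (frac (u + c)))"
      using bnd by (intro unit_uniform.integrable_const_bound[where B = pi]) (auto intro!: AE_I2 simp: abs_le_iff minus_le_iff)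
    have i2: "integrable unit_uniform (\<lambda>u. frac (u + c))"
      by (intro unit_uniform.integrable_const_bound[where B = 1]) (auto intro!: AE_I2 less_imp_le[OF frac_lt_1])
    have i3: "integrable unit_uniform (\<lambda>u. u)"
      by (intro unit_uniform.integrable_const_bound[where B = 1]) (auto intro!: AE_I2 simp: space_restrict_space)
    have "(\<integral>u. X u \<partial>unit_uniform)
        = (\<integral>u. G (frac (u + c)) + 2 * pi * (u + c - frac (u + c)) \<partial>unit_uniform)"
      by (simp add: X_def frac_def)
    also have "\<dots> = (\<integral>u. G (frac (u + c)) \<partial>unit_uniform)
        + 2 * pi * ((\<integral>u. u \<partial>unit_uniform) + c - (\<integral>u. frac (u + c) \<partial>unit_uniform))"
      using i1 i2 i3 by (simp add: space_restrict_space)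
    also have "\<dots> = 0"
      using rot[of G] rot[of "\<lambda>x. x"] by (simp add: c_def)
    finally show ?thesis .
  qed
  ultimately show ?thesis using that lift by blast
qed

section \<open>Existence of the equilibrium measure\<close>

lemma weighted_energy_angle_law:
  assumes cont: "continuous_on UNIV (\<lambda>t. Q (cis t))" and prob: "prob_space \<Omega>"
    and X: "X \<in> borel_measurable \<Omega>"
  shows "weighted_energy Q (angle_law \<Omega> X)
    = enn2ereal (log_energy \<Omega> X) + ereal ((\<integral>\<omega>. Q (cis (X \<omega>)) \<partial>\<Omega>) - ln 2)"
  unfolding weighted_energy_def free_entropy_angle_law[OF prob X] integral_angle_law[OF cont X]
  by (cases "log_energy \<Omega> X") auto

lemma tendsto_log_kernel:
  assumes "x \<longlonglongrightarrow> l"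
  shows "(\<lambda>n. log_kernel (x n)) \<longlonglongrightarrow> log_kernel l"
proof -
  have lim: "(\<lambda>n. \<bar>sin (x n / 2)\<bar>) \<longlonglongrightarrow> \<bar>sin (l / 2)\<bar>"
    using assms by (intro tendsto_intros) auto
  show ?thesis
  proof (cases "sin (l / 2) = 0")
    case False
    then have "\<forall>\<^sub>F n in sequentially. 0 < \<bar>sin (x n / 2)\<bar>"
      using order_tendstoD(1)[OF lim, of 0] by simp
    then have "\<forall>\<^sub>F n in sequentially. ennreal (- ln \<bar>sin (x n / 2)\<bar>) = log_kernel (x n)"
      by eventually_elim (simp add: log_kernel_def)
    moreover have "(\<lambda>n. ennreal (- ln \<bar>sin (x n / 2)\<bar>)) \<longlonglongrightarrow> ennreal (- ln \<bar>sin (l / 2)\<bar>)"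
      using False by (intro tendsto_ennrealI tendsto_intros lim) auto
    ultimately have "(\<lambda>n. log_kernel (x n)) \<longlonglongrightarrow> ennreal (- ln \<bar>sin (l / 2)\<bar>)"
      by (rule Lim_transform_eventually[rotated])
    with False show ?thesis by (simp add: log_kernel_def)
  next
    case True
    have "(\<lambda>n. log_kernel (x n)) \<longlonglongrightarrow> \<top>"
    proof (rule order_tendstoI)
      fix a :: ennreal assume "a < \<top>"
      then obtain r where a: "a = ennreal r" "0 \<le> r" by (cases a) auto
      have "\<forall>\<^sub>F n in sequentially. \<bar>sin (x n / 2)\<bar> < exp (- r)"
        using order_tendstoD(2)[OF lim, of "exp (- r)"] True by simp
      then show "\<forall>\<^sub>F n in sequentially. a < log_kernel (x n)"
      proof eventually_elim
        case (elim n)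
        show ?case
        proof (cases "sin (x n / 2) = 0")
          case False
          then have "ln \<bar>sin (x n / 2)\<bar> < - r"
            using elim by (metis exp_less_cancel_iff exp_ln zero_less_abs_iff)
          with False a show ?thesis by (simp add: log_kernel_def ennreal_less_iff)
        qed (simp add: log_kernel_def a)
      qed
    qed simp
    with True show ?thesis by (simp add: log_kernel_def)
  qed
qed

text \<open>
  Fatou's lemma applies to the nonnegative kernel, which is continuous with values in
  \<open>[0, \<infinity>]\<close>; the potential term converges by dominated convergence. The limit \<open>m\<close> of the energies
  may be infinite, so the potential term is moved across before passing to \<open>ennreal\<close>.
\<close>

lemma weighted_energy_lower_semicontinuous:
  fixes Y :: "nat \<Rightarrow> 'a \<Rightarrow> real"
  assumes cont: "continuous_on UNIV (\<lambda>t. Q (cis t))" and prob: "prob_space \<Omega>"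
    and Yn: "\<And>n. Y n \<in> borel_measurable \<Omega>" and Y: "Z \<in> borel_measurable \<Omega>"
    and conv: "\<And>\<omega>. \<omega> \<in> space \<Omega> \<Longrightarrow> (\<lambda>n. Y n \<omega>) \<longlonglongrightarrow> Z \<omega>"
    and lim: "(\<lambda>n. weighted_energy Q (angle_law \<Omega> (Y n))) \<longlonglongrightarrow> m"
  shows "weighted_energy Q (angle_law \<Omega> Z) \<le> m"
proof -
  interpret O: prob_space \<Omega> by fact
  interpret OO: pair_prob_space \<Omega> \<Omega> ..
  note [measurable] = Yn Y
  define e where "e = (\<lambda>n. enn2ereal (log_energy \<Omega> (Y n)))"
  define q where "q = (\<lambda>n. (\<integral>\<omega>. Q (cis (Y n \<omega>)) \<partial>\<Omega>) - ln 2)"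
  define q' where "q' = (\<integral>\<omega>. Q (cis (Z \<omega>)) \<partial>\<Omega>) - ln 2"
  from potential_bounded[OF cont] obtain C where C: "\<And>t. \<bar>Q (cis t)\<bar> \<le> C" by blast
  have [measurable]: "(\<lambda>t. Q (cis t)) \<in> borel_measurable borel"
    using cont by (rule borel_measurable_continuous_onI)
  have "(\<lambda>n. \<integral>\<omega>. Q (cis (Y n \<omega>)) \<partial>\<Omega>) \<longlonglongrightarrow> (\<integral>\<omega>. Q (cis (Z \<omega>)) \<partial>\<Omega>)"
  proof (rule integral_dominated_convergence[where w = "\<lambda>_. C"])
    show "AE \<omega> in \<Omega>. (\<lambda>n. Q (cis (Y n \<omega>))) \<longlonglongrightarrow> Q (cis (Z \<omega>))"
      by (intro AE_I2 continuous_on_tendsto_compose[OF cont]) (auto intro: conv)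
  qed (auto intro: C)
  then have "q \<longlonglongrightarrow> q'"
    unfolding q_def q'_def by (intro tendsto_intros)
  then have neg_q: "(\<lambda>n. ereal (- q n)) \<longlonglongrightarrow> ereal (- q')"
    by (intro tendsto_intros)
  have "(\<lambda>n. weighted_energy Q (angle_law \<Omega> (Y n)) + ereal (- q n)) \<longlonglongrightarrow> m + ereal (- q')"
    by (rule tendsto_add_ereal_general) (use lim neg_q in auto)
  moreover have "weighted_energy Q (angle_law \<Omega> (Y n)) + ereal (- q n) = e n" for n
    unfolding weighted_energy_angle_law[OF cont prob Yn] e_def q_def
    by (cases "log_energy \<Omega> (Y n)") auto
  ultimately have lim_e: "e \<longlonglongrightarrow> m + ereal (- q')" by simp
  then have nonneg: "m + ereal (- q') \<ge> 0"
    by (rule LIMSEQ_le_const) (auto simp: e_def)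
  have "log_energy \<Omega> Z \<le> (\<integral>\<^sup>+p. liminf (\<lambda>n. log_kernel (Y n (fst p) - Y n (snd p))) \<partial>(\<Omega> \<Otimes>\<^sub>M \<Omega>))"
    unfolding log_energy_def
  proof (rule nn_integral_mono)
    fix p assume "p \<in> space (\<Omega> \<Otimes>\<^sub>M \<Omega>)"
    then have "(\<lambda>n. Y n (fst p) - Y n (snd p)) \<longlonglongrightarrow> Z (fst p) - Z (snd p)"
      by (auto simp: space_pair_measure intro!: tendsto_diff conv)
    from lim_imp_Liminf[OF _ tendsto_log_kernel[OF this]]
    show "log_kernel (Z (fst p) - Z (snd p)) \<le> liminf (\<lambda>n. log_kernel (Y n (fst p) - Y n (snd p)))"
      by simp
  qed
  also have "\<dots> \<le> liminf (\<lambda>n. log_energy \<Omega> (Y n))"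
    unfolding log_energy_def by (rule nn_integral_liminf) measurable
  also have "\<dots> = e2ennreal (m + ereal (- q'))"
    using tendsto_e2ennrealI[OF lim_e] by (intro lim_imp_Liminf) (simp_all add: e_def)
  finally have "enn2ereal (log_energy \<Omega> Z) \<le> m + ereal (- q')"
    using nonneg by (metis enn2ereal_e2ennreal less_eq_ennreal.rep_eq)
  then show ?thesis
    unfolding weighted_energy_angle_law[OF cont prob Y] q'_def[symmetric]
    by (cases m; cases "log_energy \<Omega> Z") auto
qed

lemma tight_angles:
  assumes "\<And>n. \<mu> n \<in> circle_measures"
  shows "tight (\<lambda>n. distr (\<mu> n) borel Arg)"
  unfolding tight_def
proof (intro conjI allI impI)
  show "real_distribution (distr (\<mu> n) borel Arg)" for n
    by (rule real_distribution_Arg[OF assms])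
  fix \<epsilon> :: real assume "\<epsilon> > 0"
  have "measure (distr (\<mu> n) borel Arg) {-pi<..pi} = 1" for n
  proof -
    have "Arg -` {-pi<..pi} \<inter> space (\<mu> n) = space (\<mu> n)" using Arg_bounded by auto
    moreover have "prob_space (\<mu> n)" using assms by (simp add: circle_measures_def)
    ultimately show ?thesis
      using Arg_measurable_circle_measure[OF assms, of n]
      by (subst measure_distr) (auto simp: prob_space.prob_space)
  qed
  then show "\<exists>a b. a < b \<and> (\<forall>n. 1 - \<epsilon> < measure (distr (\<mu> n) borel Arg) {a<..b})"
    using \<open>\<epsilon> > 0\<close> by (intro exI[of _ "- pi"] exI[of _ pi]) auto
qed

text \<open>
  All arguments lie in \<open>(- pi, pi]\<close>, so a minimizing sequence is tight. A weak limit of their laws may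
  charge \<open>- pi\<close>; this is harmless because \<open>cis\<close> maps it to the same point as \<open>pi\<close>.
\<close>

lemma weighted_energy_minimizer_exists:
  assumes cont: "continuous_on UNIV (\<lambda>t. Q (cis t))"
  shows "\<exists>\<nu>\<in>circle_measures. \<forall>\<mu>\<in>circle_measures. weighted_energy Q \<nu> \<le> weighted_energy Q \<mu>"
proof -
  have "angle_law unit_uniform (\<lambda>u. 0) \<in> circle_measures"
    by (rule angle_law_circle_measures[OF prob_space_unit_uniform]) simp
  then have "weighted_energy Q ` circle_measures \<noteq> {}" by blast
  from Inf_as_limit[OF this] obtain f where f: "\<And>n. f n \<in> weighted_energy Q ` circle_measures"
    and lim: "f \<longlonglongrightarrow> Inf (weighted_energy Q ` circle_measures)" by blast
  then obtain \<mu> where \<mu>: "\<And>n. \<mu> n \<in> circle_measures" and f_eq: "\<And>n. f n = weighted_energy Q (\<mu> n)"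
    unfolding image_iff by metis
  define D where "D = (\<lambda>n. distr (\<mu> n) borel Arg)"
  have "tight D" unfolding D_def by (rule tight_angles[OF \<mu>])
  from tight_imp_convergent_subsubsequence[OF this strict_mono_id] obtain r M where r: "strict_mono (r :: nat \<Rightarrow> nat)" and M: "real_distribution M"
    and weak: "weak_conv_m (D \<circ> id \<circ> r) M"
    by blast
  have "real_distribution ((D \<circ> id \<circ> r) n)" for n
    unfolding D_def comp_def by (rule real_distribution_Arg[OF \<mu>])
  from Skorohod[OF this M weak] obtain \<Omega> :: "real measure" and Y Z where prob: "prob_space \<Omega>"
    and Y': "\<forall>n. Y n \<in> borel_measurable \<Omega>" and law': "\<forall>n. distr \<Omega> borel (Y n) = (D \<circ> id \<circ> r) n"
    and Z: "Z \<in> measurable \<Omega> lborel" and conv': "\<forall>\<omega>\<in>space \<Omega>. (\<lambda>n. Y n \<omega>) \<longlonglongrightarrow> Z \<omega>"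
    by blast
  from Y' law' conv' have Y: "\<And>n. Y n \<in> borel_measurable \<Omega>"
    and law: "\<And>n. distr \<Omega> borel (Y n) = D (r n)"
    and conv: "\<And>\<omega>. \<omega> \<in> space \<Omega> \<Longrightarrow> (\<lambda>n. Y n \<omega>) \<longlonglongrightarrow> Z \<omega>"
    by auto
  have Z': "Z \<in> borel_measurable \<Omega>" using Z by simp
  have angle: "angle_law \<Omega> (Y n) = \<mu> (r n)" for n
  proof -
    have "angle_law \<Omega> (Y n) = angle_law (D (r n)) (\<lambda>x. x)"
      by (rule angle_law_cong_law) (auto simp: Y law D_def distr_id2)
    then show ?thesis unfolding D_def angle_law_Arg[OF \<mu>] .
  qed
  have "(\<lambda>n. weighted_energy Q (angle_law \<Omega> (Y n))) \<longlonglongrightarrow> Inf (weighted_energy Q ` circle_measures)"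
    using LIMSEQ_subseq_LIMSEQ[OF lim r] by (simp add: angle comp_def f_eq)
  from weighted_energy_lower_semicontinuous[OF cont prob Y Z' conv this]
  have "weighted_energy Q (angle_law \<Omega> Z) \<le> weighted_energy Q \<mu>" if "\<mu> \<in> circle_measures" for \<mu>
    using that by (meson INF_lower order_trans)
  then show ?thesis
    using angle_law_circle_measures[OF prob Z'] by blast
qed

text \<open>
  The equilibrium measure is defined by a choice operator, so its minimizing property rests on the
  existence of a minimizer.
\<close>

lemma equilibrium_measure_minimizes:
  assumes "continuous_on UNIV (\<lambda>t. Q (cis t))"
  shows "equilibrium_measure Q \<in> circle_measures"
    and "\<mu> \<in> circle_measures \<Longrightarrow> weighted_energy Q (equilibrium_measure Q) \<le> weighted_energy Q \<mu>"
proof -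
  obtain \<nu> where \<nu>: "\<nu> \<in> circle_measures"
    "\<And>\<mu>. \<mu> \<in> circle_measures \<Longrightarrow> weighted_energy Q \<nu> \<le> weighted_energy Q \<mu>"
    using weighted_energy_minimizer_exists[OF assms] by blast
  have "equilibrium_measure Q \<in> circle_measures
      \<and> (\<forall>\<mu>\<in>circle_measures. weighted_energy Q (equilibrium_measure Q) \<le> weighted_energy Q \<mu>)"
    unfolding equilibrium_measure_def arg_min_on_def
    by (rule arg_minI[where x = \<nu>]) (use \<nu> in \<open>auto simp: not_less\<close>)
  then show "equilibrium_measure Q \<in> circle_measures"
    and "\<mu> \<in> circle_measures \<Longrightarrow> weighted_energy Q (equilibrium_measure Q) \<le> weighted_energy Q \<mu>"
    by auto
qed

section \<open>The energy gap at the minimizer\<close>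

lemma potential_semiconvex:
  fixes q :: "real \<Rightarrow> real"
  assumes "convex_on UNIV (\<lambda>t. q t - \<rho> / 2 * t\<^sup>2)" "0 \<le> s" "s \<le> 1"
  shows "q ((1 - s) * a + s * b) \<le> (1 - s) * q a + s * q b - \<rho> / 2 * (s * (1 - s) * (b - a)\<^sup>2)"
proof -
  define c d where "c = (1 - s) * a + s * b" and "d = (b - a)\<^sup>2"
  have square: "c\<^sup>2 = (1 - s) * a\<^sup>2 + s * b\<^sup>2 - s * (1 - s) * d"
    unfolding c_def d_def by (simp add: power2_eq_square algebra_simps)
  have "q c - \<rho> / 2 * c\<^sup>2 \<le> (1 - s) * (q a - \<rho> / 2 * a\<^sup>2) + s * (q b - \<rho> / 2 * b\<^sup>2)"
    using convex_onD[OF assms(1), of s a b] assms(2,3) by (simp add: c_def)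
  then have "q c \<le> (1 - s) * q a + s * q b - \<rho> / 2 * (s * (1 - s) * d)"
    unfolding square by (simp add: field_simps)
  then show ?thesis by (simp only: c_def d_def)
qed

lemma displacement_square_integrable:
  assumes X: "degree_one_lift X" and Y: "degree_one_lift Y"
  shows "integrable unit_uniform (\<lambda>u. (Y u - X u)\<^sup>2)"
proof (rule unit_uniform.integrable_const_bound)
  show "AE u in unit_uniform. norm ((Y u - X u)\<^sup>2) \<le> (\<bar>X 0\<bar> + 2 * pi + (\<bar>Y 0\<bar> + 2 * pi))\<^sup>2"
  proof (rule AE_I2)
    fix u assume "u \<in> space unit_uniform"
    then have "\<bar>Y u - X u\<bar> \<le> \<bar>X 0\<bar> + 2 * pi + (\<bar>Y 0\<bar> + 2 * pi)"
      using degree_one_lift_bounded[OF X, of u] degree_one_lift_bounded[OF Y, of u] by linarith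
    from power_mono[OF this, of 2] show "norm ((Y u - X u)\<^sup>2) \<le> (\<bar>X 0\<bar> + 2 * pi + (\<bar>Y 0\<bar> + 2 * pi))\<^sup>2"
      by simp
  qed
qed (use degree_one_lift_measurable[OF X] degree_one_lift_measurable[OF Y] in measurable)

text \<open>
  Let \<open>F\<close> be the weighted energy as a function of the lift and \<open>K\<close> the constant on the left-hand side.
  Strong convexity together with \<open>F X \<le> F Z\<close> for the intermediate lift
  \<open>Z = (1 - s) * X + s * Y\<close> gives \<open>(1 - s) * K * d \<le> F Y - F X\<close> with \<open>d\<close> the integral of \<open>(Y - X)\<^sup>2\<close>;
  then \<open>s\<close> tends to \<open>0\<close>.
\<close>

lemma displacement_energy_gap:
  fixes Q :: "complex \<Rightarrow> real"
  assumes conv: "convex_on UNIV (\<lambda>t. Q (cis t) - \<rho> / 2 * t\<^sup>2)"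
    and cont: "continuous_on UNIV (\<lambda>t. Q (cis t))"
    and X: "degree_one_lift X" and Y: "degree_one_lift Y"
    and mean: "(\<integral>u. Y u - X u \<partial>unit_uniform) = 0"
    and finX: "log_energy unit_uniform X < \<top>" and finY: "log_energy unit_uniform Y < \<top>"
    and min: "\<And>\<mu>. \<mu> \<in> circle_measures \<Longrightarrow>
        weighted_energy Q (angle_law unit_uniform X) \<le> weighted_energy Q \<mu>"
  shows "(1 + 2 * \<rho>) / 4 * (\<integral>u. (Y u - X u)\<^sup>2 \<partial>unit_uniform)
    \<le> (enn2real (log_energy unit_uniform Y) + (\<integral>u. Q (cis (Y u)) \<partial>unit_uniform))
      - (enn2real (log_energy unit_uniform X) + (\<integral>u. Q (cis (X u)) \<partial>unit_uniform))"
    (is "?K * ?d \<le> (?eY + ?qY) - (?eX + ?qX)")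
proof (rule field_le_mult_one_interval)
  fix z :: real assume z: "0 < z" "z < 1"
  define s where "s = 1 - z"
  have s: "0 < s" "s < 1" using z by (auto simp: s_def)
  define Z where "Z = (\<lambda>u. (1 - s) * X u + s * Y u)"
  have Z: "degree_one_lift Z"
    unfolding Z_def using X Y s by (intro degree_one_lift_convex) auto
  note [measurable] = degree_one_lift_measurable[OF X] degree_one_lift_measurable[OF Y]
    degree_one_lift_measurable[OF Z]
  note int = integrable_potential[OF cont prob_space_unit_uniform]
  let ?eZ = "enn2real (log_energy unit_uniform Z)"
  let ?qZ = "\<integral>u. Q (cis (Z u)) \<partial>unit_uniform"
  obtain eX eY where e: "0 \<le> eX" "0 \<le> eY" "log_energy unit_uniform X = ennreal eX"
      "log_energy unit_uniform Y = ennreal eY"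
    using finX finY by (cases "log_energy unit_uniform X"; cases "log_energy unit_uniform Y") auto
  have d: "0 \<le> ?d" by simp
  have convex: "log_energy unit_uniform Z + ennreal (s * (1 - s) / 4 * ?d) \<le> ennreal ((1 - s) * eX + s * eY)"
    using log_energy_strongly_convex[OF X Y s mean] s e
    by (simp add: Z_def flip: ennreal_mult ennreal_plus)
  have "log_energy unit_uniform Z < \<top>"
    by (rule order_le_less_trans[OF order_trans[OF _ convex]]) auto
  then obtain eZ where eZ: "0 \<le> eZ" "log_energy unit_uniform Z = ennreal eZ"
    by (cases "log_energy unit_uniform Z") auto
  have energy: "eZ + s * (1 - s) / 4 * ?d \<le> (1 - s) * eX + s * eY"
    using convex s e d eZ by (simp flip: ennreal_plus)
  note intd = displacement_square_integrable[OF X Y]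
  have "?qZ \<le> (\<integral>u. (1 - s) * Q (cis (X u)) + s * Q (cis (Y u))
      - \<rho> / 2 * (s * (1 - s) * (Y u - X u)\<^sup>2) \<partial>unit_uniform)"
  proof (rule integral_mono)
    show "Q (cis (Z u)) \<le> (1 - s) * Q (cis (X u)) + s * Q (cis (Y u))
        - \<rho> / 2 * (s * (1 - s) * (Y u - X u)\<^sup>2)" for u
      unfolding Z_def using potential_semiconvex[OF conv, of s "X u" "Y u"] s by simp
  next
    show "integrable unit_uniform (\<lambda>u. Q (cis (Z u)))" by (intro int) measurable
    show "integrable unit_uniform (\<lambda>u. (1 - s) * Q (cis (X u)) + s * Q (cis (Y u))
        - \<rho> / 2 * (s * (1 - s) * (Y u - X u)\<^sup>2))"
      by (intro Bochner_Integration.integrable_diff Bochner_Integration.integrable_add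
          integrable_mult_right int intd) measurable
  qed
  also have "\<dots> = (1 - s) * ?qX + s * ?qY - \<rho> / 2 * (s * (1 - s) * ?d)"
    by (simp add: int intd)
  finally have potential: "?qZ \<le> (1 - s) * ?qX + s * ?qY - \<rho> / 2 * (s * (1 - s) * ?d)" .
  have "weighted_energy Q (angle_law unit_uniform X) \<le> weighted_energy Q (angle_law unit_uniform Z)"
    by (intro min angle_law_circle_measures prob_space_unit_uniform) measurable
  then have "eX + ?qX \<le> eZ + ?qZ"
    using e eZ by (simp add: weighted_energy_angle_law[OF cont prob_space_unit_uniform])
  with energy potential have "s * ((1 - s) * (?K * ?d)) \<le> s * ((eY + ?qY) - (eX + ?qX))"
    by (simp add: algebra_simps add_divide_distrib diff_divide_distrib)
  then have "(1 - s) * (?K * ?d) \<le> (eY + ?qY) - (eX + ?qX)"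
    using s by simp
  then show "z * (?K * ?d) \<le> (?eY + ?qY) - (?eX + ?qX)"
    using e by (simp add: s_def)
qed

section \<open>Wasserstein distances\<close>

lemma wasserstein_bdd_below: "bdd_below ((\<lambda>\<pi>. sqrt (\<integral>p. 1/2 * (d (fst p) (snd p))\<^sup>2 \<partial>\<pi>)) ` couplings \<mu> \<nu>)"
  by (rule bdd_belowI[of _ 0]) (auto intro!: integral_nonneg_AE)

lemma angle_coupling:
  assumes prob: "prob_space \<Omega>" and [measurable]: "X \<in> borel_measurable \<Omega>" "Y \<in> borel_measurable \<Omega>"
  shows "distr \<Omega> (restrict_space borel circle \<Otimes>\<^sub>M restrict_space borel circle) (\<lambda>\<omega>. (cis (X \<omega>), cis (Y \<omega>)))
    \<in> couplings (angle_law \<Omega> X) (angle_law \<Omega> Y)"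
proof -
  let ?C = "restrict_space borel circle :: complex measure"
  have [measurable]: "(\<lambda>\<omega>. (cis (X \<omega>), cis (Y \<omega>))) \<in> measurable \<Omega> (?C \<Otimes>\<^sub>M ?C)" by measurable
  show ?thesis
    unfolding couplings_def angle_law_def
    by (auto simp: distr_distr comp_def intro!: prob_space.prob_space_distr[OF prob])
qed

lemma integrable_angular_dist_square:
  assumes "\<pi> \<in> couplings \<mu> \<nu>"
  shows "integrable \<pi> (\<lambda>p. 1/2 * (angular_dist (fst p) (snd p))\<^sup>2)"
proof -
  have prob: "prob_space \<pi>"
    and sets: "sets \<pi> = sets (restrict_space borel circle \<Otimes>\<^sub>M restrict_space borel circle)"
    using assms by (auto simp: couplings_def)
  interpret prob_space \<pi> by (rule prob)
  have [measurable]: "(\<lambda>p. angular_dist (fst p) (snd p)) \<in> borel_measurable \<pi>"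
    using angular_dist_measurable measurable_cong_sets[OF sets refl] by blast
  have "(angular_dist z w)\<^sup>2 \<le> pi\<^sup>2" for z w
    using angular_dist_le_pi[of z w] by (intro power_mono) (auto simp: angular_dist_def)
  then have "integrable \<pi> (\<lambda>p. (angular_dist (fst p) (snd p))\<^sup>2)"
    by (intro integrable_const_bound[where B = "pi\<^sup>2"]) auto
  then show ?thesis by simp
qed

lemma wasserstein_dist_le_angular:
  assumes "couplings \<mu> \<nu> \<noteq> {}"
  shows "wasserstein dist \<mu> \<nu> \<le> wasserstein angular_dist \<mu> \<nu>"
  unfolding wasserstein_def
proof (rule cINF_mono[OF assms wasserstein_bdd_below])
  fix \<pi> assume \<pi>: "\<pi> \<in> couplings \<mu> \<nu>"
  then have sets: "sets \<pi> = sets (restrict_space borel circle \<Otimes>\<^sub>M restrict_space borel circle)"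
    by (simp add: couplings_def)
  have "(\<integral>p. 1/2 * (dist (fst p) (snd p))\<^sup>2 \<partial>\<pi>) \<le> (\<integral>p. 1/2 * (angular_dist (fst p) (snd p))\<^sup>2 \<partial>\<pi>)"
  proof (rule integral_mono'[OF integrable_angular_dist_square[OF \<pi>]])
    fix p assume "p \<in> space \<pi>"
    then have "fst p \<in> circle" "snd p \<in> circle"
      unfolding sets_eq_imp_space_eq[OF sets] by (auto simp: space_pair_measure space_restrict_space)
    from dist_le_angular_dist[OF this]
    show "1/2 * (dist (fst p) (snd p))\<^sup>2 \<le> 1/2 * (angular_dist (fst p) (snd p))\<^sup>2"
      by (intro mult_left_mono power_mono) auto
  qed simp
  then show "\<exists>\<pi>'\<in>couplings \<mu> \<nu>. sqrt (\<integral>p. 1/2 * (dist (fst p) (snd p))\<^sup>2 \<partial>\<pi>')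
      \<le> sqrt (\<integral>p. 1/2 * (angular_dist (fst p) (snd p))\<^sup>2 \<partial>\<pi>)"
    using \<pi> by (intro bexI[of _ \<pi>]) simp_all
qed

lemma wasserstein_angular_le_displacement:
  assumes prob: "prob_space \<Omega>" and [measurable]: "X \<in> borel_measurable \<Omega>" "Y \<in> borel_measurable \<Omega>"
    and int: "integrable \<Omega> (\<lambda>\<omega>. (X \<omega> - Y \<omega>)\<^sup>2)"
  shows "wasserstein angular_dist (angle_law \<Omega> X) (angle_law \<Omega> Y)
    \<le> sqrt (1/2 * (\<integral>\<omega>. (X \<omega> - Y \<omega>)\<^sup>2 \<partial>\<Omega>))"
proof -
  let ?CC = "restrict_space borel circle \<Otimes>\<^sub>M restrict_space borel circle :: (complex \<times> complex) measure"
  define \<pi> where "\<pi> = distr \<Omega> ?CC (\<lambda>\<omega>. (cis (X \<omega>), cis (Y \<omega>)))"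
  have [measurable]: "(\<lambda>\<omega>. (cis (X \<omega>), cis (Y \<omega>))) \<in> measurable \<Omega> ?CC" by measurable
  have "(\<integral>p. 1/2 * (angular_dist (fst p) (snd p))\<^sup>2 \<partial>\<pi>)
      = (\<integral>\<omega>. 1/2 * (angular_dist (cis (X \<omega>)) (cis (Y \<omega>)))\<^sup>2 \<partial>\<Omega>)"
    unfolding \<pi>_def by (subst integral_distr) auto
  also have "\<dots> \<le> (\<integral>\<omega>. 1/2 * (X \<omega> - Y \<omega>)\<^sup>2 \<partial>\<Omega>)"
  proof (rule integral_mono')
    fix \<omega>
    have "(angular_dist (cis (X \<omega>)) (cis (Y \<omega>)))\<^sup>2 \<le> \<bar>X \<omega> - Y \<omega>\<bar>\<^sup>2"
      by (intro power_mono angular_dist_cis_le) (simp add: angular_dist_def)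
    then show "1/2 * (angular_dist (cis (X \<omega>)) (cis (Y \<omega>)))\<^sup>2 \<le> 1/2 * (X \<omega> - Y \<omega>)\<^sup>2" by simp
  qed (use int in auto)
  finally have "sqrt (\<integral>p. 1/2 * (angular_dist (fst p) (snd p))\<^sup>2 \<partial>\<pi>)
      \<le> sqrt (1/2 * (\<integral>\<omega>. (X \<omega> - Y \<omega>)\<^sup>2 \<partial>\<Omega>))" by simp
  moreover have "\<pi> \<in> couplings (angle_law \<Omega> X) (angle_law \<Omega> Y)"
    unfolding \<pi>_def by (rule angle_coupling[OF prob]) auto
  ultimately show ?thesis
    unfolding wasserstein_def by (intro cINF_lower2[OF wasserstein_bdd_below])
qed

section \<open>The transportation cost inequality\<close>

theorem theorem5p1:
  fixes Q :: "complex \<Rightarrow> real" and \<rho> :: real and \<mu> :: "complex measure"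
  assumes "\<rho> > - 1/2"
    and "convex_on UNIV (\<lambda>t::real. Q (exp (\<i> * complex_of_real t)) - \<rho> / 2 * t\<^sup>2)"
    and "\<mu> \<in> circle_measures"
  shows "wasserstein dist \<mu> (equilibrium_measure Q) \<le> wasserstein angular_dist \<mu> (equilibrium_measure Q)
    \<and> ereal (wasserstein angular_dist \<mu> (equilibrium_measure Q))
       \<le> ereal_sqrt (ereal (2 / (1 + 2 * \<rho>)) * relative_free_entropy Q \<mu>)"
proof -
  define \<nu> where "\<nu> = equilibrium_measure Q"
  have conv: "convex_on UNIV (\<lambda>t. Q (cis t) - \<rho> / 2 * t\<^sup>2)"
    using assms(2) by (simp add: cis_conv_exp)
  have "continuous_on UNIV (\<lambda>t. (Q (cis t) - \<rho> / 2 * t\<^sup>2) + \<rho> / 2 * t\<^sup>2)"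
    using convex_on_continuous[OF open_UNIV conv]
    by (rule continuous_on_add) (intro continuous_intros)
  then have cont: "continuous_on UNIV (\<lambda>t. Q (cis t))" by simp
  have \<nu>: "\<nu> \<in> circle_measures"
    and min: "\<And>\<mu>. \<mu> \<in> circle_measures \<Longrightarrow> weighted_energy Q \<nu> \<le> weighted_energy Q \<mu>"
    using equilibrium_measure_minimizes[OF cont] by (auto simp: \<nu>_def)
  obtain X where X: "degree_one_lift X" "angle_law unit_uniform X = \<nu>" "(\<integral>u. X u \<partial>unit_uniform) = 0"
    by (rule circle_measure_centred_lift[OF \<nu>])
  obtain Y where Y: "degree_one_lift Y" "angle_law unit_uniform Y = \<mu>" "(\<integral>u. Y u \<partial>unit_uniform) = 0"
    by (rule circle_measure_centred_lift[OF assms(3)])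
  note [measurable] = degree_one_lift_measurable[OF X(1)] degree_one_lift_measurable[OF Y(1)]
  let ?eX = "log_energy unit_uniform X" and ?eY = "log_energy unit_uniform Y"
  let ?qX = "\<integral>u. Q (cis (X u)) \<partial>unit_uniform" and ?qY = "\<integral>u. Q (cis (Y u)) \<partial>unit_uniform"
  have first: "wasserstein dist \<mu> \<nu> \<le> wasserstein angular_dist \<mu> \<nu>"
    using angle_coupling[OF prob_space_unit_uniform, of Y X] X(2) Y(2)
    by (intro wasserstein_dist_le_angular) auto
  have entropy: "relative_free_entropy Q \<mu>
      = - (ereal (ln 2) - enn2ereal ?eY) + ereal ?qY + (ereal (ln 2) - enn2ereal ?eX - ereal ?qX)"
    unfolding relative_free_entropy_def B_const_def \<nu>_def[symmetric] X(2)[symmetric] Y(2)[symmetric]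
    by (simp add: free_entropy_angle_law[OF prob_space_unit_uniform]
      integral_angle_law[OF cont])
  have "ereal (wasserstein angular_dist \<mu> \<nu>)
      \<le> ereal_sqrt (ereal (2 / (1 + 2 * \<rho>)) * relative_free_entropy Q \<mu>)"
  proof (cases "?eY = \<top>")
    \<comment> \<open>Infinite energy of the measure makes the right-hand side infinite, whatever the value of the additive constant.\<close>
    case True
    then have "relative_free_entropy Q \<mu> = \<infinity>" unfolding entropy by simp
    then show ?thesis using assms(1) by (simp add: ereal_sqrt_def)
  next
    case False
    \<comment> \<open>The minimum is finite because the given measure has finite energy.\<close>
    have "weighted_energy Q \<nu> \<le> weighted_energy Q \<mu>" by (rule min[OF assms(3)])
    with False have "?eX \<noteq> \<top>"
      unfolding X(2)[symmetric] Y(2)[symmetric]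
      by (cases ?eY) (auto simp: weighted_energy_angle_law[OF cont prob_space_unit_uniform])
    note ints = degree_one_lift_integrable[OF X(1)] degree_one_lift_integrable[OF Y(1)]
    define d where "d = (\<integral>u. (Y u - X u)\<^sup>2 \<partial>unit_uniform)"
    define R where "R = (enn2real ?eY + ?qY) - (enn2real ?eX + ?qX)"
    have gap: "(1 + 2 * \<rho>) / 4 * d \<le> R"
      unfolding d_def R_def
    proof (rule displacement_energy_gap[OF conv cont X(1) Y(1)])
      show "(\<integral>u. Y u - X u \<partial>unit_uniform) = 0" using ints X(3) Y(3) by simp
      show "?eX < \<top>" "?eY < \<top>" using False \<open>?eX \<noteq> \<top>\<close> by (auto simp: top.not_eq_extremum)
      show "weighted_energy Q (angle_law unit_uniform X) \<le> weighted_energy Q \<mu>'"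
        if "\<mu>' \<in> circle_measures" for \<mu>' using min[OF that] X(2) by simp
    qed
    have "wasserstein angular_dist \<mu> \<nu> \<le> sqrt (1/2 * d)"
      unfolding d_def X(2)[symmetric] Y(2)[symmetric]
      by (intro wasserstein_angular_le_displacement prob_space_unit_uniform displacement_square_integrable X Y) measurable
    also have "\<dots> \<le> sqrt (2 / (1 + 2 * \<rho>) * R)"
      using gap assms(1) by (intro real_sqrt_le_mono) (simp add: field_simps)
    finally have "wasserstein angular_dist \<mu> \<nu> \<le> sqrt (2 / (1 + 2 * \<rho>) * R)" .
    moreover have "relative_free_entropy Q \<mu> = ereal R"
      unfolding entropy R_def using False \<open>?eX \<noteq> \<top>\<close>
      by (cases ?eX; cases ?eY) auto
    ultimately show ?thesis by (simp add: ereal_sqrt_def)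
  qed
  with first show ?thesis by (simp add: \<nu>_def)
qed

end
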